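(* For all $n\ge1$ and any modal formula $\varphi$, the following are equivalent: 1. $\varphi$ is a theorem of $\mathrm{S4}\mathbb{C}_n$; 2. $\varphi$ is C-valid in all hereditarily $(n+1)$-irresolvable topological spaces; 3. $\varphi$ is C-valid in all finite hereditarily $(n+1)$-irresolvable topological spaces of size at most $2^k$, where $k$ is the number of subformulas of $\varphi$.
   Context: Modal formulas are built from variables by $\top,\neg,\wedge,\Box$, with $\Diamond=\neg\Box\neg$, $\Box^*\varphi=\varphi\wedge\Box\varphi$. A normal logic is a set of formulas containing all tautologies and all instances of $\Box(\varphi\to\psi)\to(\Box\varphi\to\Box\psi)$, closed under modus ponens, $\Box$-generalisation and uniform substitution. Define $\mathbb{P}_0(\varphi_0)=\Diamond\varphi_0$, $\mathbb{P}_n(\varphi_0,\dots,\varphi_n)=\Diamond(\varphi_1\wedge\mathbb{P}_{n-1}(\varphi_0,\varphi_2,\dots,\varphi_n))$ for $n>0$; $\mathbb{D}_n=\bigwedge_{i<j\le n}\neg(\varphi_i\wedge\varphi_j)$; $\mathbb{C}_n$ is the scheme $\Box^*\mathbb{D}_n\to(\Diamond\varphi_0\to\Diamond(\varphi_0\wedge\neg\mathbb{P}_n))$. $\mathrm{S4}\mathbb{C}_n$ is the smallest normal logic containing all instances of $\Box\varphi\to\Box\Box\varphi$, $\Box\varphi\to\varphi$ and $\mathbb{C}_n$. C-semantics: a topological model on space $X$ assigns subsets of $X$ to variables, Boolean connectives are set operations, $\Box$ is interior (so $\Diamond$ is closure); $\varphi$ is C-valid in $X$ if its truth set is $X$ in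 every model on $X$. For $k\ge2$, a space is $k$-resolvable if it has $k$ pairwise disjoint dense subsets, $k$-irresolvable otherwise, and hereditarily $k$-irresolvable if every non-empty subspace is $k$-irresolvable. *)

theory Defs
  imports "HOL-Analysis.Abstract_Topology"
begin

section \<open>Modal formulas\<close>

datatype 'v fm =
    Var 'v
  | Verum
  | Neg "'v fm"
  | And "'v fm" "'v fm"
  | Box "'v fm"

definition Imp :: "'v fm \<Rightarrow> 'v fm \<Rightarrow> 'v fm" where
  "Imp \<phi> \<psi> = Neg (And \<phi> (Neg \<psi>))"

definition Dia :: "'v fm \<Rightarrow> 'v fm" where
  "Dia \<phi> = Neg (Box (Neg \<phi>))"

definition Box_star :: "'v fm \<Rightarrow> 'v fm" where
  "Box_star \<phi> = And \<phi> (Box \<phi>)"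

fun subformulas :: "'v fm \<Rightarrow> 'v fm set" where
  "subformulas (Var p) = {Var p}"
| "subformulas Verum = {Verum}"
| "subformulas (Neg \<phi>) = insert (Neg \<phi>) (subformulas \<phi>)"
| "subformulas (And \<phi> \<psi>) = insert (And \<phi> \<psi>) (subformulas \<phi> \<union> subformulas \<psi>)"
| "subformulas (Box \<phi>) = insert (Box \<phi>) (subformulas \<phi>)"

fun subst :: "('v \<Rightarrow> 'v fm) \<Rightarrow> 'v fm \<Rightarrow> 'v fm" where
  "subst \<sigma> (Var p) = \<sigma> p"
| "subst \<sigma> Verum = Verum"
| "subst \<sigma> (Neg \<phi>) = Neg (subst \<sigma> \<phi>)"
| "subst \<sigma> (And \<phi> \<psi>) = And (subst \<sigma> \<phi>) (subst \<sigma> \<psi>)"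
| "subst \<sigma> (Box \<phi>) = Box (subst \<sigma> \<phi>)"


section \<open>Normal logics\<close>

text \<open>In a tautology, variables and boxed formulas are the propositional atoms.\<close>

fun prop_eval :: "('v fm \<Rightarrow> bool) \<Rightarrow> 'v fm \<Rightarrow> bool" where
  "prop_eval v (Var p) = v (Var p)"
| "prop_eval v Verum = True"
| "prop_eval v (Neg \<phi>) = (\<not> prop_eval v \<phi>)"
| "prop_eval v (And \<phi> \<psi>) = (prop_eval v \<phi> \<and> prop_eval v \<psi>)"
| "prop_eval v (Box \<phi>) = v (Box \<phi>)"

definition tautology :: "'v fm \<Rightarrow> bool" where
  "tautology \<phi> \<longleftrightarrow> (\<forall>v. prop_eval v \<phi>)"

definition normal_logic :: "'v fm set \<Rightarrow> bool" where
  "normal_logic L \<longleftrightarrow>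
     (\<forall>\<phi>. tautology \<phi> \<longrightarrow> \<phi> \<in> L) \<and>
     (\<forall>\<phi> \<psi>. Imp (Box (Imp \<phi> \<psi>)) (Imp (Box \<phi>) (Box \<psi>)) \<in> L) \<and>
     (\<forall>\<phi> \<psi>. \<phi> \<in> L \<longrightarrow> Imp \<phi> \<psi> \<in> L \<longrightarrow> \<psi> \<in> L) \<and>
     (\<forall>\<phi>. \<phi> \<in> L \<longrightarrow> Box \<phi> \<in> L) \<and>
     (\<forall>\<phi> \<sigma>. \<phi> \<in> L \<longrightarrow> subst \<sigma> \<phi> \<in> L)"

text \<open>
  A tuple $(\varphi_0,\dots,\varphi_n)$ is given by its head $\varphi_0$ and the list
  $[\varphi_1,\dots,\varphi_n]$, so $n$ is the length of the list.
\<close>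

fun P_fm :: "'v fm \<Rightarrow> 'v fm list \<Rightarrow> 'v fm" where
  "P_fm \<phi>0 [] = Dia \<phi>0"
| "P_fm \<phi>0 (\<phi>1 # \<phi>s) = Dia (And \<phi>1 (P_fm \<phi>0 \<phi>s))"

fun Conj :: "'v fm list \<Rightarrow> 'v fm" where
  "Conj [] = Verum"
| "Conj [\<phi>] = \<phi>"
| "Conj (\<phi> # \<psi> # \<chi>s) = And \<phi> (Conj (\<psi> # \<chi>s))"

definition D_fm :: "'v fm list \<Rightarrow> 'v fm" where
  "D_fm \<phi>s = Conj [Neg (And (\<phi>s ! i) (\<phi>s ! j)). j \<leftarrow> [0..<length \<phi>s], i \<leftarrow> [0..<j]]"

definition C_fm :: "'v fm \<Rightarrow> 'v fm list \<Rightarrow> 'v fm" where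
  "C_fm \<phi>0 \<phi>s =
     Imp (Box_star (D_fm (\<phi>0 # \<phi>s)))
         (Imp (Dia \<phi>0) (Dia (And \<phi>0 (Neg (P_fm \<phi>0 \<phi>s)))))"

definition S4C :: "nat \<Rightarrow> 'v fm set" where
  "S4C n = \<Inter> {L. normal_logic L \<and>
     (\<forall>\<phi>. Imp (Box \<phi>) (Box (Box \<phi>)) \<in> L) \<and>
     (\<forall>\<phi>. Imp (Box \<phi>) \<phi> \<in> L) \<and>
     (\<forall>\<phi>0 \<phi>s. length \<phi>s = n \<longrightarrow> C_fm \<phi>0 \<phi>s \<in> L)}"


section \<open>C-semantics\<close>

fun truth_set :: "'a topology \<Rightarrow> ('v \<Rightarrow> 'a set) \<Rightarrow> 'v fm \<Rightarrow> 'a set" where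
  "truth_set X V (Var p) = V p"
| "truth_set X V Verum = topspace X"
| "truth_set X V (Neg \<phi>) = topspace X - truth_set X V \<phi>"
| "truth_set X V (And \<phi> \<psi>) = truth_set X V \<phi> \<inter> truth_set X V \<psi>"
| "truth_set X V (Box \<phi>) = X interior_of (truth_set X V \<phi>)"

definition C_valid :: "'a topology \<Rightarrow> 'v fm \<Rightarrow> bool" where
  "C_valid X \<phi> \<longleftrightarrow>
     (\<forall>V. (\<forall>p. V p \<subseteq> topspace X) \<longrightarrow> truth_set X V \<phi> = topspace X)"

lemma truth_set_Dia: "truth_set X V (Dia \<phi>) = X closure_of (truth_set X V \<phi>)"
  by (simp add: Dia_def closure_of_interior_of)


section \<open>Resolvability\<close>

definition resolvable :: "nat \<Rightarrow> 'a topology \<Rightarrow> bool" where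
  "resolvable k X \<longleftrightarrow>
     (\<exists>D :: nat \<Rightarrow> 'a set.
        (\<forall>i<k. D i \<subseteq> topspace X \<and> X closure_of (D i) = topspace X) \<and>
        (\<forall>i<k. \<forall>j<k. i \<noteq> j \<longrightarrow> D i \<inter> D j = {}))"

definition hereditarily_irresolvable :: "nat \<Rightarrow> 'a topology \<Rightarrow> bool" where
  "hereditarily_irresolvable k X \<longleftrightarrow>
     (\<forall>S. S \<subseteq> topspace X \<and> S \<noteq> {} \<longrightarrow> \<not> resolvable k (subtopology X S))"

text \<open>
  HOL cannot quantify over types inside a formula, so "all topological spaces" is rendered
  as all topologies over an arbitrary infinite type.  Spaces of every cardinality are covered
  as that type varies, and each finite space has a homeomorphic copy over every infinite type.
\<close>

end

theory Submission
  imports Defs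
begin

text \<open>
  Soundness: if \<open>\<C>\<^sub>n\<close> fails at a point, then in a neighbourhood the sets
  \<open>\<phi>\<^sub>i \<and> \<diamond>(\<phi>\<^sub>i\<^sub>+\<^sub>1 \<and> \<dots>)\<close> lie, cyclically, each in the closure of the next, so they are
  \<open>n + 1\<close> disjoint dense subsets of their union.

  Completeness: filtrate the canonical model through the subformulas of \<open>\<phi>\<close>.  Clusters of the
  filtration may be too large.  In each cluster choose a canonical world that sees a minimal set of
  points of that cluster.  Every world it sees inside the cluster then sees that same set, so if the
  set had \<open>n + 1\<close> points, their characteristic formulas would refute \<open>\<C>\<^sub>n\<close>.  Together with the points
  strictly above, this set suffices to witness all diamonds of the cluster, so the rest of the
  cluster can be split into singletons below it without changing the set of points.
\<close>

section \<open>Soundness\<close>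

lemma truth_set_subset_topspace:
  assumes "\<And>p. V p \<subseteq> topspace X"
  shows "truth_set X V \<phi> \<subseteq> topspace X"
  using assms by (induction \<phi>) (auto dest: interior_of_subset_topspace[THEN subsetD])

lemma truth_set_subst:
  "truth_set X V (subst \<sigma> \<phi>) = truth_set X (\<lambda>p. truth_set X V (\<sigma> p)) \<phi>"
  by (induction \<phi>) auto

text \<open>The clauses other than \<open>Var\<close> and \<open>Box\<close> act as Boolean
  operations point by point, so membership at a fixed point is a propositional valuation with
  variables and boxed formulas as atoms. Hence tautologies are valid.\<close>

lemma mem_truth_set_prop_eval:
  assumes "x \<in> topspace X"
  shows "x \<in> truth_set X V \<phi> \<longleftrightarrow> prop_eval (\<lambda>\<psi>. x \<in> truth_set X V \<psi>) \<phi>"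
  using assms by (induction \<phi>) auto

lemma mem_truth_set_Imp:
  assumes "x \<in> topspace X"
  shows "x \<in> truth_set X V (Imp \<phi> \<psi>) \<longleftrightarrow> (x \<in> truth_set X V \<phi> \<longrightarrow> x \<in> truth_set X V \<psi>)"
  using assms by (auto simp: Imp_def)

lemma C_valid_iff:
  "C_valid X \<phi> \<longleftrightarrow>
     (\<forall>V. (\<forall>p. V p \<subseteq> topspace X) \<longrightarrow> (\<forall>x\<in>topspace X. x \<in> truth_set X V \<phi>))"
  unfolding C_valid_def using truth_set_subset_topspace by blast

lemma normal_logic_C_valid:
  fixes X :: "'a topology"
  shows "normal_logic {\<phi> :: 'v fm. C_valid X \<phi>}"
  unfolding normal_logic_def mem_Collect_eq
proof (intro conjI allI impI)
  fix \<phi> :: "'v fm" assume "tautology \<phi>"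
  then show "C_valid X \<phi>"
    unfolding C_valid_iff tautology_def
    by (intro allI impI ballI) (erule mem_truth_set_prop_eval[THEN iffD2], blast)
next
  fix \<phi> \<psi> :: "'v fm"
  show "C_valid X (Imp (Box (Imp \<phi> \<psi>)) (Imp (Box \<phi>) (Box \<psi>)))"
    unfolding C_valid_iff
  proof (intro allI impI ballI)
    fix V :: "'v \<Rightarrow> 'a set" and x
    assume V: "\<forall>p. V p \<subseteq> topspace X" and x: "x \<in> topspace X"
    have "truth_set X V (Imp \<phi> \<psi>) \<inter> truth_set X V \<phi> \<subseteq> truth_set X V \<psi>"
      using V truth_set_subset_topspace[of V X] mem_truth_set_Imp[of _ X V \<phi> \<psi>] by blast
    then have "X interior_of (truth_set X V (Imp \<phi> \<psi>)) \<inter> X interior_of (truth_set X V \<phi>)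
        \<subseteq> X interior_of (truth_set X V \<psi>)"
      by (metis interior_of_Int interior_of_mono)
    then show "x \<in> truth_set X V (Imp (Box (Imp \<phi> \<psi>)) (Imp (Box \<phi>) (Box \<psi>)))"
      using x by (auto simp: mem_truth_set_Imp)
  qed
next
  fix \<phi> \<psi> :: "'v fm" assume "C_valid X \<phi>" "C_valid X (Imp \<phi> \<psi>)"
  then show "C_valid X \<psi>"
    by (auto simp: C_valid_iff mem_truth_set_Imp)
next
  fix \<phi> :: "'v fm" assume "C_valid X \<phi>"
  then show "C_valid X (Box \<phi>)"
    by (auto simp: C_valid_def)
next
  fix \<phi> :: "'v fm" and \<sigma> :: "'v \<Rightarrow> 'v fm" assume "C_valid X \<phi>"
  then show "C_valid X (subst \<sigma> \<phi>)"
    unfolding C_valid_def truth_set_subst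
    using truth_set_subset_topspace[of _ X] by (metis (lifting))
qed

section \<open>The scheme C_n in hereditarily irresolvable spaces\<close>

lemma mem_truth_set_Conj:
  assumes "x \<in> topspace X"
  shows "x \<in> truth_set X V (Conj \<phi>s) \<longleftrightarrow> (\<forall>\<phi>\<in>set \<phi>s. x \<in> truth_set X V \<phi>)"
  using assms by (induction \<phi>s rule: Conj.induct) auto

lemma mem_truth_set_D_fm:
  assumes "x \<in> truth_set X V (D_fm \<phi>s)" and "x \<in> topspace X"
    and "i < length \<phi>s" and "j < length \<phi>s" and "i \<noteq> j"
    and "x \<in> truth_set X V (\<phi>s ! i)"
  shows "x \<notin> truth_set X V (\<phi>s ! j)"
proof -
  have *: "x \<notin> truth_set X V (\<phi>s ! i) \<or> x \<notin> truth_set X V (\<phi>s ! j)"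
    if ij: "i < j" "j < length \<phi>s" for i j
  proof -
    have "Neg (And (\<phi>s ! i) (\<phi>s ! j)) \<in>
        set [Neg (And (\<phi>s ! i) (\<phi>s ! j)). j \<leftarrow> [0..<length \<phi>s], i \<leftarrow> [0..<j]]"
      using ij by (auto intro!: bexI[of _ j])
    then have "x \<in> truth_set X V (Neg (And (\<phi>s ! i) (\<phi>s ! j)))"
      using assms(1) unfolding D_fm_def mem_truth_set_Conj[OF assms(2)] by blast
    then show ?thesis by simp
  qed
  show ?thesis
    using *[of i j] *[of j i] assms(3-) by (meson linorder_neqE_nat)
qed

text \<open>A failure at \<open>x\<close> gives an open neighbourhood \<open>G\<close> on which
  disjointness holds and every point of \<open>\<phi>0\<close> lies in the closure of
  \<open>N \<phi>s\<close>. This bends the chain of nested closures into a cycle, and the union of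
  its links is a resolvable subspace.\<close>

lemma C_valid_C_fm:
  fixes X :: "'a topology" and \<phi>0 :: "'v fm"
  assumes irr: "hereditarily_irresolvable (length \<phi>s + 1) X"
  shows "C_valid X (C_fm \<phi>0 \<phi>s)"
  unfolding C_valid_iff
proof (intro allI impI ballI)
  fix V :: "'v \<Rightarrow> 'a set" and x
  assume V: "\<forall>p. V p \<subseteq> topspace X" and x: "x \<in> topspace X"
  let ?T = "truth_set X V"
  have T_sub: "?T \<psi> \<subseteq> topspace X" for \<psi>
    using V truth_set_subset_topspace by blast
  \<comment> \<open>\<open>N\<close> omits the outermost diamond of \<open>P_fm\<close>: the truth
    set of \<open>P_fm \<phi>0 \<psi>s\<close> is the closure of \<open>N \<psi>s\<close>.\<close>
  define N where "N = rec_list (?T \<phi>0) (\<lambda>\<psi> _ S. ?T \<psi> \<inter> X closure_of S)"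
  have N_simps: "N [] = ?T \<phi>0" "N (\<psi> # \<psi>s) = ?T \<psi> \<inter> X closure_of N \<psi>s" for \<psi> \<psi>s
    by (simp_all add: N_def)
  have N_P: "?T (P_fm \<phi>0 \<psi>s) = X closure_of N \<psi>s" for \<psi>s
    by (induction \<psi>s) (simp_all add: truth_set_Dia N_simps)
  let ?n = "length \<phi>s"
  let ?As = "\<phi>0 # \<phi>s"
  have "x \<in> ?T (Dia (And \<phi>0 (Neg (P_fm \<phi>0 \<phi>s))))"
    if D: "x \<in> ?T (Box (D_fm ?As))" and Dia: "x \<in> ?T (Dia \<phi>0)"
  proof (rule ccontr)
    assume "\<not> ?thesis"
    then have neg: "x \<notin> X closure_of (?T \<phi>0 - X closure_of N \<phi>s)"
      using T_sub by (simp add: truth_set_Dia N_P Diff_eq Int_assoc[symmetric])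
        (metis Int_absorb2 Int_assoc Int_commute)
    obtain U where U: "openin X U" "x \<in> U" "U \<subseteq> ?T (D_fm ?As)"
      using D by (auto simp: interior_of_def)
    obtain O' where O': "openin X O'" "x \<in> O'" "O' \<inter> (?T \<phi>0 - X closure_of N \<phi>s) = {}"
      using neg x by (fastforce simp: in_closure_of)
    define G where "G = U \<inter> O'"
    have G: "openin X G" "x \<in> G" "G \<inter> ?T \<phi>0 \<subseteq> X closure_of N \<phi>s" "G \<subseteq> ?T (D_fm ?As)"
      using U O' by (auto simp: G_def)
    \<comment> \<open>Link \<open>i < ?n\<close> lies in the truth set of
      \<open>\<phi>s ! i\<close>; link \<open>?n\<close>, from the empty suffix, is the part of the
      truth set of \<open>\<phi>0\<close> in \<open>G\<close>.\<close>
    define B where "B i = G \<inter> N (drop i \<phi>s)" for i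
    have G_cl: "G \<inter> X closure_of S \<subseteq> X closure_of (G \<inter> S)" for S
      using G(1) openin_Int_closure_of_subset by blast
    have step: "B i \<subseteq> X closure_of (B (Suc i))" if "i < ?n" for i
    proof -
      have "N (drop i \<phi>s) \<subseteq> X closure_of (N (drop (Suc i) \<phi>s))"
        using that by (simp add: Cons_nth_drop_Suc[symmetric] N_simps)
      then show ?thesis
        unfolding B_def using G_cl by blast
    qed
    \<comment> \<open>The failure of the consequent of C_n enters here: it leads from the last link
      back to the first.\<close>
    have wrap: "B ?n \<subseteq> X closure_of (B 0)"
      unfolding B_def using G(3) G_cl by (fastforce simp: N_simps)
    have up: "X closure_of B i \<subseteq> X closure_of B j" if "i \<le> j" "j \<le> ?n" for i j
      using that
    proof (induction j rule: dec_induct)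
      case (step j)
      have "X closure_of B j \<subseteq> X closure_of B (Suc j)"
        using \<open>\<And>i. i < ?n \<Longrightarrow> B i \<subseteq> X closure_of (B (Suc i))\<close>[of j] step.prems
        by (simp add: closure_of_minimal)
      with step show ?case by simp
    qed auto
    \<comment> \<open>From \<open>i\<close> the chain runs up to the last link, wraps to link 0 and
      climbs to \<open>j\<close>, so all links have the same closure.\<close>
    have eq: "X closure_of B i \<subseteq> X closure_of B j" if "i \<le> ?n" "j \<le> ?n" for i j
      using up[of i ?n] up[of 0 j] wrap that closure_of_minimal[OF wrap closedin_closure_of]
      by blast
    have B_top: "B i \<subseteq> topspace X" for i
      using openin_subset[OF G(1)] by (auto simp: B_def)
    define S where "S = (\<Union>i\<le>?n. B i)"
    have "x \<in> X closure_of (?T \<phi>0)"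
      using Dia by (simp add: truth_set_Dia)
    then have "B ?n \<noteq> {}"
      using G by (auto simp: B_def N_simps in_closure_of)
    then have "S \<noteq> {}" "S \<subseteq> topspace X"
      using B_top by (auto simp: S_def)
    moreover have "resolvable (?n + 1) (subtopology X S)"
      unfolding resolvable_def
    proof (intro exI[of _ B] conjI allI impI)
      fix i assume i: "i < ?n + 1"
      then have BS: "B i \<subseteq> S" unfolding S_def by (intro UN_upper) simp
      then show "B i \<subseteq> topspace (subtopology X S)"
        using B_top by auto
      have "S \<subseteq> X closure_of B i"
        unfolding S_def
      proof (rule UN_least)
        fix j assume "j \<in> {..?n}"
        then show "B j \<subseteq> X closure_of B i"
          using eq[of j i] i closure_of_subset[OF B_top, of j] by simp
      qed
      then show "subtopology X S closure_of B i = topspace (subtopology X S)"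
        using BS \<open>S \<subseteq> topspace X\<close> by (auto simp: closure_of_subtopology Int_absorb1)
    next
      fix i j assume ij: "i < ?n + 1" "j < ?n + 1" "i \<noteq> j"
      \<comment> \<open>\<open>\<phi>0\<close> heads the list \<open>?As\<close> but belongs to the
        last link, hence the cyclic shift.\<close>
      define f where "f i = (if i < ?n then Suc i else 0)" for i
      have BT: "B i \<subseteq> ?T (?As ! f i)" if "i < ?n + 1" for i
      proof (cases "i < ?n")
        case True
        then show ?thesis
          by (auto simp: B_def f_def Cons_nth_drop_Suc[symmetric] N_simps)
      next
        case False
        then show ?thesis
          using that by (auto simp: B_def f_def N_simps)
      qed
      have "f i \<noteq> f j" "f i < length ?As" "f j < length ?As"
        using ij by (auto simp: f_def)
      then have "y \<notin> ?T (?As ! f j)" if y: "y \<in> G" "y \<in> ?T (?As ! f i)" for y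
        using mem_truth_set_D_fm[of y X V ?As "f i" "f j"] y G(4) T_sub by blast
      then show "B i \<inter> B j = {}"
        using BT ij by (fastforce simp: B_def)
    qed
    ultimately show False
      using irr by (auto simp: hereditarily_irresolvable_def)
  qed
  then show "x \<in> ?T (C_fm \<phi>0 \<phi>s)"
    using x by (simp add: C_fm_def Box_star_def mem_truth_set_Imp)
qed

text \<open>The formulas valid in \<open>X\<close> form a normal logic containing all three axiom
  schemes, and \<open>S4C n\<close> is the least such set.\<close>

lemma soundness:
  assumes "\<phi> \<in> S4C n" and "hereditarily_irresolvable (n + 1) X"
  shows "C_valid X \<phi>"
proof -
  have "C_valid X (Imp (Box \<psi>) (Box (Box \<psi>)))" "C_valid X (Imp (Box \<psi>) \<psi>)" for \<psi> :: "'a fm"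
    by (auto simp: C_valid_iff mem_truth_set_Imp dest: interior_of_subset[THEN subsetD])
  moreover have "C_valid X (C_fm \<phi>0 \<phi>s)" if "length \<phi>s = n" for \<phi>0 :: "'a fm" and \<phi>s
    using C_valid_C_fm that assms(2) by blast
  ultimately have "\<phi> \<in> {\<phi>. C_valid X \<phi>}"
    using assms(1) normal_logic_C_valid unfolding S4C_def by blast
  then show ?thesis by simp
qed

section \<open>Alexandroff topologies of finite preorders\<close>

text \<open>The open sets are the subsets of \<open>A\<close> closed upwards under \<open>r\<close>.
  For a preorder the interior is then the Kripke box, which turns frames into spaces.\<close>

definition alexandroff :: "'a set \<Rightarrow> ('a \<Rightarrow> 'a \<Rightarrow> bool) \<Rightarrow> 'a topology" where
  "alexandroff A r = topology (\<lambda>U. U \<subseteq> A \<and> (\<forall>x\<in>U. \<forall>y\<in>A. r x y \<longrightarrow> y \<in> U))"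

lemma openin_alexandroff:
  "openin (alexandroff A r) U \<longleftrightarrow> U \<subseteq> A \<and> (\<forall>x\<in>U. \<forall>y\<in>A. r x y \<longrightarrow> y \<in> U)"
proof -
  have "istopology (\<lambda>U. U \<subseteq> A \<and> (\<forall>x\<in>U. \<forall>y\<in>A. r x y \<longrightarrow> y \<in> U))"
    unfolding istopology_def by blast
  then show ?thesis
    by (simp add: alexandroff_def topology_inverse')
qed

lemma topspace_alexandroff [simp]: "topspace (alexandroff A r) = A"
  unfolding topspace_def openin_alexandroff by blast

locale preorder_on_set =
  fixes A :: "'a set" and r :: "'a \<Rightarrow> 'a \<Rightarrow> bool"
  assumes refl: "x \<in> A \<Longrightarrow> r x x"
    and trans: "x \<in> A \<Longrightarrow> y \<in> A \<Longrightarrow> z \<in> A \<Longrightarrow> r x y \<Longrightarrow> r y z \<Longrightarrow> r x z"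
begin

lemma openin_upset: "x \<in> A \<Longrightarrow> openin (alexandroff A r) {y \<in> A. r x y}"
  unfolding openin_alexandroff using trans by blast

lemma interior_of_alexandroff:
  "alexandroff A r interior_of S = {x \<in> A. \<forall>y\<in>A. r x y \<longrightarrow> y \<in> S}" (is "_ = ?I")
proof (rule interior_of_unique)
  show "?I \<subseteq> S" using refl by blast
  show "openin (alexandroff A r) ?I" unfolding openin_alexandroff using trans by blast
qed (auto simp: openin_alexandroff)

text \<open>Take a point with fewest successors in \<open>S\<close>. Moving along \<open>r\<close>
  can only shrink the successor set, so it stays the same, and by reflexivity it contains the
  starting point.\<close>

lemma ex_maximal:
  assumes "finite S" "S \<noteq> {}" "S \<subseteq> A"
  obtains x where "x \<in> S" "\<And>y. y \<in> S \<Longrightarrow> r x y \<Longrightarrow> r y x"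
proof -
  obtain x where x: "x \<in> S" "\<And>y. y \<in> S \<Longrightarrow> card {z \<in> S. r x z} \<le> card {z \<in> S. r y z}"
    using ex_has_least_nat[of "\<lambda>x. x \<in> S" _ "\<lambda>x. card {z \<in> S. r x z}"] assms(2) by blast
  have "r y x" if y: "y \<in> S" "r x y" for y
  proof -
    have "{z \<in> S. r y z} \<subseteq> {z \<in> S. r x z}"
      using trans[of x y] x y assms(3) by blast
    then have "{z \<in> S. r y z} = {z \<in> S. r x z}"
      using x(2)[OF y(1)] assms(1) by (simp add: card_seteq)
    then show ?thesis
      using x(1) refl assms(3) by blast
  qed
  with x(1) show ?thesis using that by blast
qed

text \<open>In a non-empty subspace pick a maximal point. Its successors there lie in its own
  cluster and every dense set meets them, so \<open>n + 1\<close> disjoint dense sets would need a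
  cluster of more than \<open>n\<close> points.\<close>

lemma hereditarily_irresolvable_alexandroff:
  assumes fin: "finite A"
    and clusters: "\<And>x. x \<in> A \<Longrightarrow> card {y \<in> A. r x y \<and> r y x} \<le> n"
  shows "hereditarily_irresolvable (n + 1) (alexandroff A r)"
  unfolding hereditarily_irresolvable_def
proof (intro allI impI notI, elim conjE)
  fix S assume S: "S \<subseteq> topspace (alexandroff A r)" "S \<noteq> {}"
    and "resolvable (n + 1) (subtopology (alexandroff A r) S)"
  then obtain D :: "nat \<Rightarrow> 'a set" where
    D_dense: "\<forall>i<n + 1. D i \<subseteq> topspace (subtopology (alexandroff A r) S) \<and>
      subtopology (alexandroff A r) S closure_of D i = topspace (subtopology (alexandroff A r) S)"
    and disj: "\<forall>i<n + 1. \<forall>j<n + 1. i \<noteq> j \<longrightarrow> D i \<inter> D j = {}"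
    unfolding resolvable_def by (elim exE conjE)
  have SA: "S \<subseteq> A" using S by simp
  have D: "D i \<subseteq> S \<and> S \<subseteq> alexandroff A r closure_of (D i)" if "i < n + 1" for i
  proof -
    have "D i \<subseteq> S" "subtopology (alexandroff A r) S closure_of D i = S"
      using D_dense[rule_format, OF that] SA by (simp_all add: Int_absorb1)
    then show ?thesis
      by (metis closure_of_subtopology Int_absorb1 Int_lower2)
  qed
  obtain x where x: "x \<in> S" "\<And>y. y \<in> S \<Longrightarrow> r x y \<Longrightarrow> r y x"
    using ex_maximal[OF finite_subset[OF SA fin] S(2) SA] by blast
  have "\<exists>y. y \<in> D i \<and> r x y" if "i < n + 1" for i
  proof -
    have "x \<in> alexandroff A r closure_of (D i)"
      using D[OF that] x by blast
    then have "\<forall>U. x \<in> U \<and> openin (alexandroff A r) U \<longrightarrow> (\<exists>y. y \<in> D i \<and> y \<in> U)"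
      unfolding in_closure_of by (rule conjunct2)
    moreover have "x \<in> {y \<in> A. r x y}" "openin (alexandroff A r) {y \<in> A. r x y}"
      using openin_upset refl x(1) SA by auto
    ultimately show ?thesis
      by (metis (lifting) mem_Collect_eq)
  qed
  then obtain d where d: "\<And>i. i < n + 1 \<Longrightarrow> d i \<in> D i \<and> r x (d i)"
    by metis
  have "inj_on d {..<n + 1}"
  proof (rule inj_onI)
    fix i j assume "i \<in> {..<n + 1}" "j \<in> {..<n + 1}" "d i = d j"
    then show "i = j"
      using d[of i] d[of j] disj by (metis IntI empty_iff lessThan_iff)
  qed
  moreover have "d ` {..<n + 1} \<subseteq> {y \<in> A. r x y \<and> r y x}"
  proof (rule image_subsetI)
    fix i assume "i \<in> {..<n + 1}"
    then have "d i \<in> S" "r x (d i)"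
      using d[of i] D[of i] by auto
    then show "d i \<in> {y \<in> A. r x y \<and> r y x}"
      using x(2) SA by blast
  qed
  ultimately have "n + 1 \<le> card {y \<in> A. r x y \<and> r y x}"
    using card_inj_on_le[of d "{..<n + 1}"] fin by simp
  then show False
    using clusters[of x] x(1) SA by auto
qed

end

section \<open>The canonical model\<close>

lemma finite_subformulas: "finite (subformulas \<phi>)"
  by (induction \<phi>) auto

lemma self_in_subformulas: "\<phi> \<in> subformulas \<phi>"
  by (cases \<phi>) auto

locale normal_modal_logic =
  fixes L :: "'v fm set"
  assumes normal: "normal_logic L"
begin

lemma taut: "tautology \<phi> \<Longrightarrow> \<phi> \<in> L"
  and K: "Imp (Box (Imp \<phi> \<psi>)) (Imp (Box \<phi>) (Box \<psi>)) \<in> L"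
  and nec: "\<phi> \<in> L \<Longrightarrow> Box \<phi> \<in> L"
  using normal unfolding normal_logic_def by blast+

text \<open>Closure under modus ponens but not under generalisation captures local consequence, for
  which the deduction theorem holds.\<close>

definition is_theory :: "'v fm set \<Rightarrow> bool" where
  "is_theory T \<longleftrightarrow> L \<subseteq> T \<and> (\<forall>\<phi> \<psi>. \<phi> \<in> T \<longrightarrow> Imp \<phi> \<psi> \<in> T \<longrightarrow> \<psi> \<in> T)"

lemma is_theory_L: "is_theory L"
  using normal unfolding normal_logic_def is_theory_def by blast

lemma is_theory_taut: "is_theory T \<Longrightarrow> tautology \<phi> \<Longrightarrow> \<phi> \<in> T"
  and is_theory_mp: "is_theory T \<Longrightarrow> Imp \<phi> \<psi> \<in> T \<Longrightarrow> \<phi> \<in> T \<Longrightarrow> \<psi> \<in> T"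
  using taut unfolding is_theory_def by blast+

text \<open>By the deduction theorem, this set is what \<open>T\<close> together with
  \<open>\<psi>\<close> proves.\<close>

lemma is_theory_adjoin:
  assumes T: "is_theory T"
  shows "is_theory {\<chi>. Imp \<psi> \<chi> \<in> T}"
  unfolding is_theory_def
proof (intro conjI allI impI subsetI; clarify)
  fix \<chi> assume "\<chi> \<in> L"
  moreover have "Imp \<chi> (Imp \<psi> \<chi>) \<in> T"
    by (rule is_theory_taut[OF T]) (simp add: tautology_def Imp_def)
  ultimately show "Imp \<psi> \<chi> \<in> T"
    using T unfolding is_theory_def by blast
next
  fix \<phi> \<chi> assume "Imp \<psi> \<phi> \<in> T" "Imp \<psi> (Imp \<phi> \<chi>) \<in> T"
  moreover have "Imp (Imp \<psi> \<phi>) (Imp (Imp \<psi> (Imp \<phi> \<chi>)) (Imp \<psi> \<chi>)) \<in> T"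
    by (rule is_theory_taut[OF T]) (auto simp: tautology_def Imp_def)
  ultimately show "Imp \<psi> \<chi> \<in> T"
    using is_theory_mp[OF T] by blast
qed

definition world :: "'v fm set \<Rightarrow> bool" where
  "world x \<longleftrightarrow> is_theory x \<and> (\<forall>\<phi>. Neg \<phi> \<in> x \<longleftrightarrow> \<phi> \<notin> x)"

text \<open>Zorn's lemma gives a theory maximal among those omitting \<open>\<phi>\<close>.
  Adjoining any missing \<open>\<psi>\<close> then proves \<open>\<phi>\<close>, so
  \<open>\<phi>\<close> acts as falsum in showing that exactly one of \<open>\<psi>\<close> and
  \<open>Neg \<psi>\<close> belongs.\<close>

lemma lindenbaum:
  assumes T: "is_theory T" and "\<phi> \<notin> T"
  obtains x where "world x" "T \<subseteq> x" "\<phi> \<notin> x"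
proof -
  let ?A = "{S. is_theory S \<and> T \<subseteq> S \<and> \<phi> \<notin> S}"
  have "\<exists>M\<in>?A. \<forall>S\<in>?A. M \<subseteq> S \<longrightarrow> S = M"
  proof (rule subset_Zorn_nonempty)
    show "?A \<noteq> {}" using assms by blast
    fix \<C> assume ne: "\<C> \<noteq> {}" and chain: "subset.chain ?A \<C>"
    have "\<psi> \<in> \<Union>\<C>" if mp: "\<chi> \<in> \<Union>\<C>" "Imp \<chi> \<psi> \<in> \<Union>\<C>" for \<chi> \<psi>
    proof -
      obtain S S' where "S \<in> \<C>" "S' \<in> \<C>" "\<chi> \<in> S" "Imp \<chi> \<psi> \<in> S'"
        using mp by blast
      moreover from this have "S \<subseteq> S' \<or> S' \<subseteq> S"
        using chain unfolding subset_chain_def by blast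
      ultimately obtain S where "S \<in> \<C>" "\<chi> \<in> S" "Imp \<chi> \<psi> \<in> S" by blast
      moreover from this have "is_theory S"
        using chain unfolding subset_chain_def by blast
      ultimately show ?thesis
        using is_theory_mp by blast
    qed
    moreover have "\<forall>S\<in>\<C>. L \<subseteq> S \<and> T \<subseteq> S \<and> \<phi> \<notin> S"
      using chain unfolding subset_chain_def is_theory_def by blast
    ultimately show "\<Union>\<C> \<in> ?A"
      using ne unfolding is_theory_def by blast
  qed
  then obtain x where x: "is_theory x" "T \<subseteq> x" "\<phi> \<notin> x"
    and max: "\<And>S. is_theory S \<Longrightarrow> x \<subseteq> S \<Longrightarrow> \<phi> \<notin> S \<Longrightarrow> S = x"
    by (smt (verit) mem_Collect_eq order_trans)
  have adjoin: "Imp \<psi> \<phi> \<in> x" if "\<psi> \<notin> x" for \<psi>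
  proof (rule ccontr)
    assume "Imp \<psi> \<phi> \<notin> x"
    moreover have "Imp \<chi> (Imp \<psi> \<chi>) \<in> x" for \<chi>
      by (rule is_theory_taut[OF x(1)]) (simp add: tautology_def Imp_def)
    then have "x \<subseteq> {\<chi>. Imp \<psi> \<chi> \<in> x}"
      using is_theory_mp[OF x(1)] by blast
    ultimately have "{\<chi>. Imp \<psi> \<chi> \<in> x} = x"
      using max[OF is_theory_adjoin[OF x(1)]] by blast
    moreover have "Imp \<psi> \<psi> \<in> x"
      by (rule is_theory_taut[OF x(1)]) (simp add: tautology_def Imp_def)
    ultimately show False using that by blast
  qed
  have "Neg \<psi> \<in> x \<longleftrightarrow> \<psi> \<notin> x" for \<psi>
  proof
    have "Imp \<psi> (Imp (Neg \<psi>) \<phi>) \<in> x"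
      by (rule is_theory_taut[OF x(1)]) (simp add: tautology_def Imp_def)
    then show "\<psi> \<notin> x" if "Neg \<psi> \<in> x"
      using is_theory_mp[OF x(1)] that x(3) by blast
    have "Imp (Imp \<psi> \<phi>) (Imp (Imp (Neg \<psi>) \<phi>) \<phi>) \<in> x"
      by (rule is_theory_taut[OF x(1)]) (auto simp: tautology_def Imp_def)
    then show "Neg \<psi> \<in> x" if "\<psi> \<notin> x"
      using is_theory_mp[OF x(1)] that x(3) adjoin by blast
  qed
  with x(1) have "world x" by (simp add: world_def)
  then show ?thesis using that x by blast
qed

lemma world_Neg [simp]: "world x \<Longrightarrow> Neg \<phi> \<in> x \<longleftrightarrow> \<phi> \<notin> x"
  by (simp add: world_def)

lemma world_Verum [simp]: "world x \<Longrightarrow> Verum \<in> x"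
  by (simp add: world_def is_theory_taut tautology_def)

lemma world_And [simp]:
  assumes "world x"
  shows "And \<phi> \<psi> \<in> x \<longleftrightarrow> \<phi> \<in> x \<and> \<psi> \<in> x"
proof -
  have T: "is_theory x" using assms by (simp add: world_def)
  have "Imp (And \<phi> \<psi>) \<phi> \<in> x" "Imp (And \<phi> \<psi>) \<psi> \<in> x" "Imp \<phi> (Imp \<psi> (And \<phi> \<psi>)) \<in> x"
    by (rule is_theory_taut[OF T], simp add: tautology_def Imp_def)+
  then show ?thesis
    using is_theory_mp[OF T] by blast
qed

lemma world_Imp [simp]: "world x \<Longrightarrow> Imp \<phi> \<psi> \<in> x \<longleftrightarrow> (\<phi> \<in> x \<longrightarrow> \<psi> \<in> x)"
  by (simp add: Imp_def)

lemma world_Conj [simp]: "world x \<Longrightarrow> Conj \<phi>s \<in> x \<longleftrightarrow> set \<phi>s \<subseteq> x"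
  by (induction \<phi>s rule: Conj.induct) auto

lemma world_L: "world x \<Longrightarrow> \<phi> \<in> L \<Longrightarrow> \<phi> \<in> x"
  unfolding world_def is_theory_def by blast

definition acc :: "'v fm set \<Rightarrow> 'v fm set \<Rightarrow> bool" where
  "acc x y \<longleftrightarrow> world y \<and> (\<forall>\<phi>. Box \<phi> \<in> x \<longrightarrow> \<phi> \<in> y)"

lemma acc_world: "acc x y \<Longrightarrow> world y"
  by (simp add: acc_def)

text \<open>The formulas boxed in \<open>x\<close> form a theory, by K and generalisation. If
  \<open>Box \<phi>\<close> is missing, this theory omits \<open>\<phi>\<close>, and a world
  extending it without \<open>\<phi>\<close> is the required successor.\<close>

lemma world_Box:
  assumes x: "world x"
  shows "Box \<phi> \<in> x \<longleftrightarrow> (\<forall>y. acc x y \<longrightarrow> \<phi> \<in> y)"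
proof
  assume r: "\<forall>y. acc x y \<longrightarrow> \<phi> \<in> y"
  show "Box \<phi> \<in> x"
  proof (rule ccontr)
    assume "Box \<phi> \<notin> x"
    moreover have "is_theory {\<psi>. Box \<psi> \<in> x}"
      unfolding is_theory_def using nec world_L[OF x] world_L[OF x K] x by fastforce
    ultimately obtain y where "world y" "{\<psi>. Box \<psi> \<in> x} \<subseteq> y" "\<phi> \<notin> y"
      using lindenbaum by (metis mem_Collect_eq)
    then show False using r by (auto simp: acc_def)
  qed
qed (auto simp: acc_def)

lemma world_Dia: "world x \<Longrightarrow> Dia \<phi> \<in> x \<longleftrightarrow> (\<exists>y. acc x y \<and> \<phi> \<in> y)"
  using world_Neg[OF acc_world] by (simp add: Dia_def world_Box)

end

section \<open>Filtration\<close>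

locale S4C_logic = normal_modal_logic +
  fixes n :: nat
  assumes four: "Imp (Box \<phi>) (Box (Box \<phi>)) \<in> L"
    and T: "Imp (Box \<phi>) \<phi> \<in> L"
    and C: "length \<phi>s = n \<Longrightarrow> C_fm \<phi>0 \<phi>s \<in> L"
begin

lemma acc_refl: "world x \<Longrightarrow> acc x x"
  using world_L[OF _ T] by (fastforce simp: acc_def)

lemma acc_Box: "world x \<Longrightarrow> acc x y \<Longrightarrow> Box \<phi> \<in> x \<Longrightarrow> Box \<phi> \<in> y"
  using world_L[OF _ four[of \<phi>], of x] by (auto simp: acc_def)

lemma acc_trans: "world x \<Longrightarrow> acc x y \<Longrightarrow> acc y z \<Longrightarrow> acc x z"
  using acc_Box by (fastforce simp: acc_def)

end

locale filtration = S4C_logic L n for L :: "'v fm set" and n +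
  fixes \<Phi> :: "'v fm set"
  assumes finite_Phi: "finite \<Phi>"
begin

text \<open>For a trace \<open>s\<close> on \<open>\<Phi>\<close>, this formula singles out the
  worlds with that trace. \<open>Conj\<close> takes a list, so \<open>SOME\<close> fixes one
  enumeration of \<open>\<Phi>\<close>.\<close>

definition char_fm :: "'v fm set \<Rightarrow> 'v fm" where
  "char_fm s = Conj (map (\<lambda>\<psi>. if \<psi> \<in> s then \<psi> else Neg \<psi>) (SOME xs. set xs = \<Phi>))"

lemma char_fm:
  assumes "world x" "s \<subseteq> \<Phi>"
  shows "char_fm s \<in> x \<longleftrightarrow> x \<inter> \<Phi> = s"
proof -
  have "set (SOME xs. set xs = \<Phi>) = \<Phi>"
    using finite_list[OF finite_Phi] by (rule someI_ex)
  then show ?thesis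
    using assms by (fastforce simp: char_fm_def split: if_splits)
qed

text \<open>Serves as the label of a cluster: it depends only on the trace and, by axiom 4, grows
  along \<open>acc\<close>.\<close>

definition boxes :: "'v fm set \<Rightarrow> 'v fm set" where
  "boxes s = {\<psi>. Box \<psi> \<in> s \<inter> \<Phi>}"

lemma boxes_Int [simp]: "boxes (x \<inter> \<Phi>) = boxes x"
  by (simp add: boxes_def)

lemma acc_boxes: "world x \<Longrightarrow> acc x y \<Longrightarrow> boxes x \<subseteq> boxes y"
  using acc_Box by (auto simp: boxes_def)

text \<open>A cluster of the filtration is determined by the boxed formulas its members share, so the
  condition on \<^term>\<open>boxes\<close> says that \<open>z\<close> and \<open>x\<close> lie in the same cluster.\<close>

definition visible :: "'v fm set \<Rightarrow> 'v fm set set" where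
  "visible x = {z \<inter> \<Phi> | z. acc x z \<and> boxes z = boxes x}"

lemma visible_mono:
  assumes "world x" "acc x y" "boxes y = boxes x"
  shows "visible y \<subseteq> visible x"
  using assms acc_trans by (fastforce simp: visible_def)

lemma finite_visible: "finite (visible x)"
proof (rule finite_subset)
  show "visible x \<subseteq> Pow \<Phi>" by (auto simp: visible_def)
qed (simp add: finite_Phi)

section \<open>Bounding the points visible inside a cluster\<close>

lemma D_fm_char_fm:
  assumes "world x" "distinct ss" "set ss \<subseteq> Pow \<Phi>"
  shows "D_fm (map char_fm ss) \<in> x"
proof -
  have "\<not> (char_fm (ss ! i) \<in> x \<and> char_fm (ss ! j) \<in> x)" if "i < j" "j < length ss" for i j
  proof -
    have "ss ! i \<noteq> ss ! j"
      using that assms(2) by (simp add: nth_eq_iff_index_eq)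
    moreover have "ss ! i \<subseteq> \<Phi>" "ss ! j \<subseteq> \<Phi>"
      using that assms(3) nth_mem[of i ss] nth_mem[of j ss] by fastforce+
    ultimately show ?thesis
      using char_fm[OF assms(1), of "ss ! i"] char_fm[OF assms(1), of "ss ! j"] by auto
  qed
  then show ?thesis
    using assms(1) by (auto simp: D_fm_def)
qed

text \<open>Since visibility cannot shrink above \<open>x\<close> within its cluster, each world
  reached there still sees every trace visible from \<open>x\<close>. The nested diamonds are
  therefore met one after another without leaving the cluster.\<close>

lemma P_fm_char_fm:
  assumes x: "world x"
    and min: "\<And>y. acc x y \<Longrightarrow> boxes y = boxes x \<Longrightarrow> visible y = visible x"
    and "set ss \<subseteq> visible x" "s \<in> visible x" "acc x w" "boxes w = boxes x"
  shows "P_fm (char_fm s) (map char_fm ss) \<in> w"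
  using assms(3-)
proof (induction ss arbitrary: w)
  case Nil
  have "s \<in> visible w"
    using min Nil by blast
  then show ?case
    using acc_world[OF Nil(3)] acc_world char_fm by (auto simp: visible_def world_Dia)
next
  case (Cons t ss)
  have w: "world w"
    using Cons.prems acc_world by blast
  have "t \<in> visible w"
    using min Cons.prems by auto
  then obtain z where z: "acc w z" "boxes z = boxes w" "t = z \<inter> \<Phi>"
    by (auto simp: visible_def)
  then have "P_fm (char_fm s) (map char_fm ss) \<in> z"
    using Cons acc_trans[OF x] by simp
  moreover have "char_fm t \<in> z"
    using z acc_world char_fm by auto
  ultimately show ?case
    using w z acc_world[of w z] by (auto simp: world_Dia)
qed

text \<open>The characteristic formulas of \<open>n + 1\<close> visible traces exclude each other at
  every world, so C_n would yield a reachable world with trace \<open>s\<close> that refutes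
  \<open>P_fm\<close>. It still lies in the cluster, contradicting
  \<open>P_fm_char_fm\<close>.\<close>

lemma card_visible_le:
  assumes x: "world x"
    and min: "\<And>y. acc x y \<Longrightarrow> boxes y = boxes x \<Longrightarrow> visible y = visible x"
  shows "card (visible x) \<le> n"
proof (rule ccontr)
  assume "\<not> ?thesis"
  then obtain K where K: "K \<subseteq> visible x" "card K = Suc n"
    by (meson not_less_eq_eq obtain_subset_with_card_n)
  then obtain ts where "set ts = K" "distinct ts" "length ts = Suc n"
    by (metis finite_distinct_list distinct_card finite_subset finite_visible)
  \<comment> \<open>The head \<open>s\<close> takes the place of \<open>\<phi>0\<close>, leaving
    \<open>n\<close> traces for the list, the length that C_n requires.\<close>
  then obtain s ss where ss: "set (s # ss) \<subseteq> visible x" "distinct (s # ss)" "length ss = n"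
    using K(1) by (metis length_Suc_conv)
  have sub: "set (s # ss) \<subseteq> Pow \<Phi>"
    using ss(1) unfolding visible_def by blast
  obtain z where z: "acc x z" "boxes z = boxes x" "s = z \<inter> \<Phi>"
    using ss(1) by (auto simp: visible_def)
  have wz: "world z" using z acc_world by blast
  have "D_fm (map char_fm (s # ss)) \<in> y" if "world y" for y
    using D_fm_char_fm[OF that ss(2) sub] .
  then have "Box_star (D_fm (char_fm s # map char_fm ss)) \<in> z"
    using wz acc_world by (simp add: Box_star_def world_Box)
  moreover have "char_fm s \<in> z"
    using char_fm[OF wz] z by auto
  then have "Dia (char_fm s) \<in> z"
    using world_Dia[OF wz] acc_refl[OF wz] by blast
  moreover have "C_fm (char_fm s) (map char_fm ss) \<in> z"
    using world_L[OF wz C] ss(3) by simp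
  ultimately have "Dia (And (char_fm s) (Neg (P_fm (char_fm s) (map char_fm ss)))) \<in> z"
    using wz by (simp add: C_fm_def)
  then obtain w where w: "acc z w" "char_fm s \<in> w" "P_fm (char_fm s) (map char_fm ss) \<notin> w"
    using world_Dia[OF wz] acc_world by auto
  have "w \<inter> \<Phi> = s"
    using w char_fm[OF acc_world[OF w(1)]] sub by auto
  \<comment> \<open>The trace determines the label, so a world with trace \<open>s\<close> again is
    in the cluster.\<close>
  then have "boxes w = boxes x"
    using z by (metis boxes_Int)
  moreover have "acc x w"
    using acc_trans[OF x] z w by blast
  ultimately show False
    using P_fm_char_fm[OF x min, of ss s w] ss(1) w(3) by auto
qed

section \<open>The finite set of points and the cores of its clusters\<close>

definition points :: "'v fm set set" where
  "points = {x \<inter> \<Phi> | x. world x}"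

lemma finite_points: "finite points"
  and card_points: "card points \<le> 2 ^ card \<Phi>"
proof -
  have "points \<subseteq> Pow \<Phi>" by (auto simp: points_def)
  then show "finite points" "card points \<le> 2 ^ card \<Phi>"
    using finite_Phi card_mono[of "Pow \<Phi>" points] by (auto simp: card_Pow finite_subset)
qed

text \<open>Choose a world of the cluster that sees as few of its points as possible, and let
  \<open>K\<close> be what it sees. A successor refuting \<open>\<psi>\<close> either has a strictly
  larger label or stays in the cluster, where its trace is visible.\<close>

lemma ex_core:
  assumes "s \<in> points"
  obtains K where "card K \<le> n" "finite K"
    "\<And>\<psi>. Box \<psi> \<in> \<Phi> \<Longrightarrow> \<psi> \<in> \<Phi> \<Longrightarrow> Box \<psi> \<notin> s \<Longrightarrow>
       \<exists>t\<in>points. \<psi> \<notin> t \<and> (boxes s \<subset> boxes t \<or> boxes s = boxes t \<and> t \<in> K)"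
proof -
  let ?P = "\<lambda>x. world x \<and> boxes x = boxes s"
  have "\<exists>x. ?P x"
    using assms by (auto simp: points_def)
  then obtain x where x: "world x" "boxes x = boxes s"
    and least: "\<And>y. ?P y \<Longrightarrow> card (visible x) \<le> card (visible y)"
    using ex_has_least_nat[of ?P _ "\<lambda>x. card (visible x)"] by blast
  \<comment> \<open>A successor in the same cluster sees no further points by transitivity, and no
    fewer by the choice of \<open>x\<close>.\<close>
  have min: "visible y = visible x" if "acc x y" "boxes y = boxes x" for y
    using visible_mono[OF x(1) that] least[of y] that x acc_world
    by (simp add: card_seteq finite_visible)
  show ?thesis
  proof (rule that)
    show "card (visible x) \<le> n"
      using card_visible_le[OF x(1) min] .
    show "finite (visible x)" by (rule finite_visible)
    fix \<psi> assume \<psi>: "Box \<psi> \<in> \<Phi>" "\<psi> \<in> \<Phi>" "Box \<psi> \<notin> s"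
    then have "\<psi> \<notin> boxes x" using x(2) by (auto simp: boxes_def)
    then have "Box \<psi> \<notin> x" using \<psi> by (auto simp: boxes_def)
    then obtain y where y: "acc x y" "\<psi> \<notin> y"
      using world_Box[OF x(1)] by blast
    have "boxes s \<subseteq> boxes y"
      using acc_boxes[OF x(1) y(1)] x(2) by simp
    moreover have "y \<inter> \<Phi> \<in> visible x" if "boxes s = boxes y"
      using that y x by (auto simp: visible_def)
    moreover have "y \<inter> \<Phi> \<in> points"
      using acc_world[OF y(1)] by (auto simp: points_def)
    ultimately show "\<exists>t\<in>points. \<psi> \<notin> t \<and>
        (boxes s \<subset> boxes t \<or> boxes s = boxes t \<and> t \<in> visible x)"
      using y(2) by (intro bexI[of _ "y \<inter> \<Phi>"]) auto
  qed
qed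

text \<open>Indexed by the label \<open>b\<close> rather than by a point, so that all points of a
  cluster share one core; transitivity of \<open>rel\<close> rests on this.\<close>

definition core :: "'v fm set \<Rightarrow> 'v fm set set" where
  "core b = (SOME K. card K \<le> n \<and> finite K \<and> (\<forall>s\<in>points. boxes s = b \<longrightarrow>
     (\<forall>\<psi>. Box \<psi> \<in> \<Phi> \<longrightarrow> \<psi> \<in> \<Phi> \<longrightarrow> Box \<psi> \<notin> s \<longrightarrow>
       (\<exists>t\<in>points. \<psi> \<notin> t \<and> (boxes s \<subset> boxes t \<or> boxes s = boxes t \<and> t \<in> K)))))"

lemma core:
  assumes s: "s \<in> points"
  shows "card (core (boxes s)) \<le> n" "finite (core (boxes s))"
    "Box \<psi> \<in> \<Phi> \<Longrightarrow> \<psi> \<in> \<Phi> \<Longrightarrow> Box \<psi> \<notin> s \<Longrightarrow>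
       \<exists>t\<in>points. \<psi> \<notin> t \<and> (boxes s \<subset> boxes t \<or> boxes s = boxes t \<and> t \<in> core (boxes s))"
proof -
  obtain K where K: "card K \<le> n" "finite K"
    "\<And>\<psi>. Box \<psi> \<in> \<Phi> \<Longrightarrow> \<psi> \<in> \<Phi> \<Longrightarrow> Box \<psi> \<notin> s \<Longrightarrow>
       \<exists>t\<in>points. \<psi> \<notin> t \<and> (boxes s \<subset> boxes t \<or> boxes s = boxes t \<and> t \<in> K)"
    using ex_core[OF s] by blast
  \<comment> \<open>Points with one label contain the same boxed formulas of \<open>\<Phi>\<close>,
    so the set found for \<open>s\<close> serves its whole cluster.\<close>
  have Box_iff: "Box \<psi> \<in> s' \<longleftrightarrow> Box \<psi> \<in> s" if "boxes s' = boxes s" "Box \<psi> \<in> \<Phi>" for \<psi> s'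
    using that by (auto simp: boxes_def set_eq_iff)
  have "\<exists>K. card K \<le> n \<and> finite K \<and> (\<forall>s'\<in>points. boxes s' = boxes s \<longrightarrow>
     (\<forall>\<psi>. Box \<psi> \<in> \<Phi> \<longrightarrow> \<psi> \<in> \<Phi> \<longrightarrow> Box \<psi> \<notin> s' \<longrightarrow>
       (\<exists>t\<in>points. \<psi> \<notin> t \<and> (boxes s' \<subset> boxes t \<or> boxes s' = boxes t \<and> t \<in> K))))"
  proof (intro exI[of _ K] conjI ballI impI allI)
    fix s' \<psi> assume "boxes s' = boxes s" "Box \<psi> \<in> \<Phi>" "\<psi> \<in> \<Phi>" "Box \<psi> \<notin> s'"
    then show "\<exists>t\<in>points. \<psi> \<notin> t \<and> (boxes s' \<subset> boxes t \<or> boxes s' = boxes t \<and> t \<in> K)"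
      using K(3)[of \<psi>] Box_iff[of s' \<psi>] by simp
  qed (use K in auto)
  from someI_ex[OF this, folded core_def]
  show "card (core (boxes s)) \<le> n" "finite (core (boxes s))"
    "Box \<psi> \<in> \<Phi> \<Longrightarrow> \<psi> \<in> \<Phi> \<Longrightarrow> Box \<psi> \<notin> s \<Longrightarrow>
       \<exists>t\<in>points. \<psi> \<notin> t \<and> (boxes s \<subset> boxes t \<or> boxes s = boxes t \<and> t \<in> core (boxes s))"
    using s by auto
qed

text \<open>Core points with a common label stay mutually related, while each other point becomes a
  singleton cluster below them.\<close>

definition rel :: "'v fm set \<Rightarrow> 'v fm set \<Rightarrow> bool" where
  "rel s t \<longleftrightarrow> boxes s \<subset> boxes t \<or> boxes s = boxes t \<and> (t \<in> core (boxes s) \<or> s = t)"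

lemma rel_refl: "rel s s"
  by (simp add: rel_def)

lemma rel_trans: "rel s t \<Longrightarrow> rel t u \<Longrightarrow> rel s u"
  by (auto simp: rel_def)

lemma rel_cluster:
  assumes "rel s t" "rel t s"
  shows "s = t \<or> s \<in> core (boxes s) \<and> t \<in> core (boxes s)"
proof -
  have "boxes s = boxes t" using assms unfolding rel_def by blast
  then show ?thesis using assms unfolding rel_def by auto
qed

lemma card_rel_cluster:
  assumes "s \<in> points" "n \<ge> 1"
  shows "card {t \<in> points. rel s t \<and> rel t s} \<le> n"
proof (cases "s \<in> core (boxes s)")
  case True
  then have "{t \<in> points. rel s t \<and> rel t s} \<subseteq> core (boxes s)"
    using rel_cluster by blast
  then show ?thesis
    using core(1,2)[OF assms(1)] card_mono le_trans by blast
next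
  case False
  then have "{t \<in> points. rel s t \<and> rel t s} \<subseteq> {s}"
    using rel_cluster by blast
  then have "card {t \<in> points. rel s t \<and> rel t s} \<le> card {s}"
    by (intro card_mono) auto
  \<comment> \<open>A point outside the core is alone in its cluster; \<open>n \<ge> 1\<close>
    leaves room for it.\<close>
  then show ?thesis using assms(2) by simp
qed

text \<open>The box case of the truth lemma. Forwards, \<open>rel\<close> preserves boxed formulas
  of \<open>\<Phi>\<close>, and axiom T unboxes them at the target. Backwards, a strictly higher
  point or a core point supplies the counterexample.\<close>

lemma Box_mem_iff_rel:
  assumes "s \<in> points" "Box \<psi> \<in> \<Phi>" "\<psi> \<in> \<Phi>"
  shows "Box \<psi> \<in> s \<longleftrightarrow> (\<forall>t\<in>points. rel s t \<longrightarrow> \<psi> \<in> t)"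
proof
  assume "Box \<psi> \<in> s"
  show "\<forall>t\<in>points. rel s t \<longrightarrow> \<psi> \<in> t"
  proof (intro ballI impI)
    fix t assume t: "t \<in> points" "rel s t"
    then obtain y where y: "world y" "t = y \<inter> \<Phi>" by (auto simp: points_def)
    have "Box \<psi> \<in> y"
      using t(2) y(2) \<open>Box \<psi> \<in> s\<close> assms(2) by (auto simp: rel_def boxes_def)
    then show "\<psi> \<in> t"
      using world_L[OF y(1) T[of \<psi>]] y assms(3) by simp
  qed
next
  assume "\<forall>t\<in>points. rel s t \<longrightarrow> \<psi> \<in> t"
  then show "Box \<psi> \<in> s"
    using core(3)[OF assms] unfolding rel_def by blast
qed

text \<open>The truth lemma, with the points, which are sets of formulas, named by elements of
  \<open>A\<close> through \<open>g\<close>.\<close>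

lemma truth_set_alexandroff:
  fixes g :: "'a \<Rightarrow> 'v fm set"
  assumes g: "bij_betw g A points" and "subformulas \<psi> \<subseteq> \<Phi>"
  shows "truth_set (alexandroff A (\<lambda>a b. rel (g a) (g b))) (\<lambda>p. {a \<in> A. Var p \<in> g a}) \<psi>
    = {a \<in> A. \<psi> \<in> g a}"
  using assms(2)
proof (induction \<psi>)
  interpret preorder_on_set A "\<lambda>a b. rel (g a) (g b)"
    by unfold_locales (auto intro: rel_refl rel_trans)
  have g_points: "g a \<in> points" if "a \<in> A" for a
    using bij_betwE[OF g] that by blast
  then have g_world: "\<exists>x. world x \<and> g a = x \<inter> \<Phi>" if "a \<in> A" for a
    using that unfolding points_def by blast
  {
    case (Var p)
    show ?case by simp
  next
    case Verum
    then show ?case using g_world by fastforce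
  next
    case (Neg \<psi>)
    then have "\<psi> \<in> \<Phi>" "Neg \<psi> \<in> \<Phi>" using self_in_subformulas[of \<psi>] by auto
    then show ?case using Neg g_world by fastforce
  next
    case (And \<psi> \<chi>)
    then have "\<psi> \<in> \<Phi>" "\<chi> \<in> \<Phi>" "And \<psi> \<chi> \<in> \<Phi>"
      using self_in_subformulas[of \<psi>] self_in_subformulas[of \<chi>] by auto
    then show ?case using And g_world by fastforce
  next
    case (Box \<psi>)
    then have sub: "\<psi> \<in> \<Phi>" "Box \<psi> \<in> \<Phi>" using self_in_subformulas[of \<psi>] by auto
    have "(\<forall>b\<in>A. rel (g a) (g b) \<longrightarrow> \<psi> \<in> g b) \<longleftrightarrow> (\<forall>t\<in>points. rel (g a) t \<longrightarrow> \<psi> \<in> t)" for a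
      by (simp add: bij_betw_imp_surj_on[OF g, symmetric])
    then show ?case
      using Box sub g_points Box_mem_iff_rel by (auto simp: interior_of_alexandroff)
  }
qed

end

section \<open>Completeness and the equivalence\<close>

lemma S4C_logic_S4C: "S4C_logic (S4C n :: 'a fm set) n"
proof unfold_locales
  have "normal_logic (\<Inter>\<L>)" if "\<And>L. L \<in> \<L> \<Longrightarrow> normal_logic L" for \<L> :: "'a fm set set"
    using that unfolding normal_logic_def by (smt (verit) InterE InterI)
  then show "normal_logic (S4C n :: 'a fm set)"
    unfolding S4C_def by (metis (lifting) mem_Collect_eq)
qed (auto simp: S4C_def)

lemma completeness:
  fixes \<phi> :: "'v fm"
  assumes n: "n \<ge> 1" and inf: "infinite (UNIV :: 'a set)" and "\<phi> \<notin> S4C n"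
  obtains X :: "'a topology" where "hereditarily_irresolvable (n + 1) X"
    "finite (topspace X)" "card (topspace X) \<le> 2 ^ card (subformulas \<phi>)" "\<not> C_valid X \<phi>"
proof -
  interpret S4C_logic "S4C n :: 'v fm set" n by (rule S4C_logic_S4C)
  interpret filtration "S4C n :: 'v fm set" n "subformulas \<phi>"
    by unfold_locales (rule finite_subformulas)
  \<comment> \<open>The countermodel must live on the type \<open>'a\<close>, which is infinite and
    so has room for a copy of the finite set \<open>points\<close>.\<close>
  obtain A :: "'a set" where A: "finite A" "card A = card points"
    using infinite_arbitrarily_large[OF inf] by blast
  then obtain g where g: "bij_betw g A points"
    using finite_same_card_bij finite_points by blast
  interpret preorder_on_set A "\<lambda>a b. rel (g a) (g b)"
    by unfold_locales (auto intro: rel_refl rel_trans)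
  let ?X = "alexandroff A (\<lambda>a b. rel (g a) (g b))"
  show ?thesis
  proof (rule that)
    show "hereditarily_irresolvable (n + 1) ?X"
    proof (rule hereditarily_irresolvable_alexandroff[OF A(1)])
      fix a assume "a \<in> A"
      then have "g a \<in> points" using bij_betwE[OF g] by blast
      have "inj_on g {b \<in> A. rel (g a) (g b) \<and> rel (g b) (g a)}"
        using bij_betw_imp_inj_on[OF g] by (rule inj_on_subset) auto
      then have "card {b \<in> A. rel (g a) (g b) \<and> rel (g b) (g a)}
          \<le> card {t \<in> points. rel (g a) t \<and> rel t (g a)}"
        by (rule card_inj_on_le) (use bij_betwE[OF g] finite_points in auto)
      also have "\<dots> \<le> n"
        using card_rel_cluster[OF \<open>g a \<in> points\<close> n] .
      finally show "card {b \<in> A. rel (g a) (g b) \<and> rel (g b) (g a)} \<le> n" .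
    qed
    show "finite (topspace ?X)" "card (topspace ?X) \<le> 2 ^ card (subformulas \<phi>)"
      using A card_points by auto
    obtain x where "world x" "\<phi> \<notin> x"
      using lindenbaum[OF is_theory_L assms(3)] by blast
    then have "x \<inter> subformulas \<phi> \<in> points" "\<phi> \<notin> x \<inter> subformulas \<phi>"
      by (auto simp: points_def)
    then obtain a where "a \<in> A" "\<phi> \<notin> g a"
      using bij_betw_imp_surj_on[OF g] by (metis imageE)
    then have "truth_set ?X (\<lambda>p. {a \<in> A. Var p \<in> g a}) \<phi> \<noteq> topspace ?X"
      using truth_set_alexandroff[OF g, of \<phi>] by auto
    then show "\<not> C_valid ?X \<phi>"
      unfolding C_valid_def by (auto intro!: exI[of _ "\<lambda>p. {a \<in> A. Var p \<in> g a}"])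
  qed
qed

theorem theorem8p3:
  fixes n :: nat and \<phi> :: "'v fm"
  assumes "n \<ge> 1" and "infinite (UNIV :: 'a set)"
  shows "(\<phi> \<in> S4C n \<longleftrightarrow>
            (\<forall>X :: 'a topology. hereditarily_irresolvable (n + 1) X \<longrightarrow> C_valid X \<phi>)) \<and>
         (\<phi> \<in> S4C n \<longleftrightarrow>
            (\<forall>X :: 'a topology. hereditarily_irresolvable (n + 1) X \<longrightarrow>
               finite (topspace X) \<longrightarrow> card (topspace X) \<le> 2 ^ card (subformulas \<phi>) \<longrightarrow>
               C_valid X \<phi>))"
  \<comment> \<open>The countermodel of a non-theorem is both finite and small, so it gives both
    converses at once.\<close>
  using soundness completeness[OF assms] by metis

end
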